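(* Let $\mathbf{a}=(a_i)_{i\in\mathbb{Z}}$ be pairwise distinct indeterminates (or complex numbers chosen so that all denominators below are nonzero), and let $A_{\mathbf a}(n,k)$ be the generalized Eulerian numbers. Then for all $n\ge 0$ and $0\le k\le n$, \[ A_{\mathbf a}(n,k)=\sum_{j=0}^{k}\Big(\prod_{\substack{i=0\\ i\neq k-j}}^{n}\frac{a_{n-k+1}-a_{i-k}}{a_{-j}-a_{i-k}}\Big)\, a_{-j}^{\,n}. \]
   Context: For $n\ge 0$, the generalized Eulerian numbers $A_{\mathbf a}(n,k)$, $0\le k\le n$, are defined as the (unique) coefficients in the polynomial identity in the variable $z$ \[ z^n=\sum_{k=0}^{n} A_{\mathbf a}(n,k)\prod_{i=1}^{n}\frac{z-a_{i-k}}{a_{n-k+1}-a_{i-k}}, \] and $A_{\mathbf a}(n,k)=0$ for $k<0$ or $k>n$. *)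

theory Defs
  imports Complex_Main "HOL-Computational_Algebra.Polynomial"
begin

(* The defining identity is an identity of polynomials in z over a field K, where the
   parameters form a family a :: int => K.  Taking K = complex gives complex parameters;
   taking K to be a field of rational functions in variables a_i gives indeterminates. *)
definition is_eulerian_coeffs :: "(int \<Rightarrow> 'a::field) \<Rightarrow> nat \<Rightarrow> (int \<Rightarrow> 'a) \<Rightarrow> bool" where
  "is_eulerian_coeffs a n c \<longleftrightarrow>
     [:0, 1:] ^ n =
       (\<Sum>k\<in>{0..int n}. smult (c k)
          (\<Prod>i\<in>{1..int n}. smult (1 / (a (int n - k + 1) - a (i - k))) ([:0, 1:] - [:a (i - k):])))
     \<and> (\<forall>k. k < 0 \<or> k > int n \<longrightarrow> c k = 0)"

(* The vanishing clause above makes the coefficient family unique as a function on all of int,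
   so that the definite description is meaningful when the a_i are pairwise distinct. *)
definition gen_eulerian :: "(int \<Rightarrow> 'a::field) \<Rightarrow> nat \<Rightarrow> int \<Rightarrow> 'a" where
  "gen_eulerian a n = (THE c. is_eulerian_coeffs a n c)"

end

(* The basis polynomial B_l vanishes exactly at a_{1-l}, ..., a_{n-l}.  Hence its values at the nodes
   a_0, a_{-1}, ..., a_{-n} are triangular in l, so the B_l span the polynomials of degree at most n.
   The right-hand side is the linear functional phi_k that interpolates at a_{-k}, ..., a_{n-k},
   evaluates at a_{n-k+1}, and keeps only the contributions of a_{-k}, ..., a_0.  It is dual to the
   basis: for l > k all retained values of B_l vanish, for l = k only the node a_{-k} contributes,
   and for l < k the discarded values and the value at a_{n-k+1} all vanish. *)
theory Submission
  imports Defs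
begin

lemma degree_prod_le_card:
  assumes "finite A" "\<And>i. i \<in> A \<Longrightarrow> degree (f i) \<le> 1"
  shows "degree (prod f A) \<le> card A"
  using degree_prod_sum_le[OF assms(1), of f] sum_bounded_above[of A "degree \<circ> f" 1] assms(2)
  by simp

text \<open>The interpolant \<open>q\<close> and \<open>p\<close> both have degree below
  \<open>card S\<close> and agree at the \<open>card S\<close> distinct nodes, so they coincide. The
  point \<open>z\<close> may lie off the nodes.\<close>

lemma Lagrange_interpolation:
  fixes a :: "'b \<Rightarrow> 'a::field" and p :: "'a poly"
  assumes "finite S" "inj_on a S" "degree p < card S"
  shows "poly p z = (\<Sum>s\<in>S. (\<Prod>t\<in>S - {s}. (z - a t) / (a s - a t)) * poly p (a s))"
proof -
  define L where "L s = (\<Prod>t\<in>S - {s}. smult (1 / (a s - a t)) [:- a t, 1:])" for s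
  define q where "q = (\<Sum>s\<in>S. smult (poly p (a s)) (L s))"
  have poly_L: "poly (L s) x = (\<Prod>t\<in>S - {s}. (x - a t) / (a s - a t))" for s x
    by (simp add: L_def poly_prod diff_divide_distrib)
  have deg_L: "degree (L s) < card S" if "s \<in> S" for s
  proof -
    have "degree (L s) \<le> card (S - {s})"
      unfolding L_def using assms(1)
      by (intro degree_prod_le_card order_trans[OF degree_smult_le]) auto
    also have "\<dots> < card S"
      using that assms(1) by (intro psubset_card_mono) auto
    finally show ?thesis .
  qed
  have "degree q < card S"
  proof -
    \<comment> \<open>Since \<open>degree p < card S\<close>, the set \<open>S\<close> is nonempty,
      so this truncated subtraction still yields a strict bound.\<close>
    have "degree q \<le> card S - 1"
      unfolding q_def
    proof (rule degree_sum_le[OF assms(1)])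
      fix s assume "s \<in> S"
      then show "degree (smult (poly p (a s)) (L s)) \<le> card S - 1"
        using deg_L[of s] degree_smult_le[of "poly p (a s)" "L s"] by linarith
    qed
    then show ?thesis
      using assms(3) by linarith
  qed
  moreover have "poly p x = poly q x" if "x \<in> a ` S" for x
  proof -
    from that obtain r where r: "r \<in> S" "x = a r" by blast
    have "poly (L s) (a r) = (if s = r then 1 else 0)" if "s \<in> S" for s
    proof (cases "s = r")
      case True
      then show ?thesis
        unfolding poly_L using that inj_on_eq_iff[OF assms(2)]
        by (auto intro!: prod.neutral split: if_splits)
    next
      case False
      then show ?thesis
        unfolding poly_L using r assms(1) by (auto intro!: prod_zero)
    qed
    then have "poly q x = (\<Sum>s\<in>S. poly p (a s) * (if s = r then 1 else 0))"
      unfolding q_def r(2) poly_sum by (intro sum.cong) auto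
    also have "\<dots> = poly p x"
      using r assms(1) by (simp add: if_distrib cong: if_cong)
    finally show ?thesis by simp
  qed
  ultimately have "p = q"
    using assms by (intro poly_eqI_degree[where A = "a ` S"]) (auto simp: card_image)
  then have "poly p z = poly q z"
    by simp
  then show ?thesis
    by (simp add: q_def poly_sum poly_L mult.commute)
qed

text \<open>Forward substitution: equation \<open>j\<close> brings in one new unknown,
  \<open>c j\<close>, with nonzero coefficient, and leaves the earlier equations untouched.\<close>

lemma triangular_system_solvable:
  fixes M :: "nat \<Rightarrow> nat \<Rightarrow> 'a::field"
  assumes "\<And>j. j \<le> m \<Longrightarrow> M j j \<noteq> 0"
  shows "\<exists>c. \<forall>j\<le>m. (\<Sum>l\<le>j. c l * M l j) = f j"
  using assms
proof (induction m)
  case 0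
  then show ?case
    by (intro exI[of _ "\<lambda>_. f 0 / M 0 0"]) auto
next
  case (Suc m)
  then obtain c where c: "\<And>j. j \<le> m \<Longrightarrow> (\<Sum>l\<le>j. c l * M l j) = f j"
    by (metis le_SucI)
  define d where
    "d = c(Suc m := (f (Suc m) - (\<Sum>l\<le>m. c l * M l (Suc m))) / M (Suc m) (Suc m))"
  have eq: "(\<Sum>l\<le>j. d l * M l i) = (\<Sum>l\<le>j. c l * M l i)" if "j \<le> m" for i j
    using that by (intro sum.cong) (auto simp: d_def)
  have "(\<Sum>l\<le>j. d l * M l j) = f j" if "j \<le> Suc m" for j
  proof (cases "j = Suc m")
    case True
    then show ?thesis
      using Suc.prems[of "Suc m"] eq[of m] by (simp add: d_def)
  next
    case False
    then show ?thesis
      using that eq c by simp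
  qed
  then show ?case by blast
qed

definition eulerian_basis :: "(int \<Rightarrow> 'a::field) \<Rightarrow> nat \<Rightarrow> int \<Rightarrow> 'a poly" where
  "eulerian_basis a n k =
     (\<Prod>i\<in>{1..int n}. smult (1 / (a (int n - k + 1) - a (i - k))) ([:0, 1:] - [:a (i - k):]))"

lemma poly_eulerian_basis:
  "poly (eulerian_basis a n k) z =
     (\<Prod>i\<in>{1..int n}. (z - a (i - k)) / (a (int n - k + 1) - a (i - k)))"
  by (simp add: eulerian_basis_def poly_prod diff_divide_distrib)

lemma degree_eulerian_basis_le: "degree (eulerian_basis a n k) \<le> n"
proof -
  have "degree (eulerian_basis a n k) \<le> card {1..int n}"
    unfolding eulerian_basis_def
    by (intro degree_prod_le_card order_trans[OF degree_smult_le]) auto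
  then show ?thesis by simp
qed

lemma poly_eulerian_basis_eq_0:
  assumes "m \<in> {1 - l..int n - l}"
  shows "poly (eulerian_basis a n l) (a m) = 0"
  unfolding poly_eulerian_basis
  using assms by (intro prod_zero) (auto intro!: bexI[of _ "m + l"])

lemma poly_eulerian_basis_neq_0:
  assumes "inj a" "m \<notin> {1 - l..int n - l}"
  shows "poly (eulerian_basis a n l) (a m) \<noteq> 0"
  unfolding poly_eulerian_basis using assms by (auto simp: inj_eq)

text \<open>This is the \<open>phi_k\<close> described above. Only the outer sum is cut off at 0;
  the weights still involve all \<open>n + 1\<close> nodes.\<close>

definition eulerian_functional :: "(int \<Rightarrow> 'a::field) \<Rightarrow> nat \<Rightarrow> int \<Rightarrow> 'a poly \<Rightarrow> 'a" where
  "eulerian_functional a n k p =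
     (\<Sum>s\<in>{-k..0}. (\<Prod>t\<in>{-k..int n - k} - {s}. (a (int n - k + 1) - a t) / (a s - a t)) * poly p (a s))"

lemma eulerian_functional_sum_smult:
  "eulerian_functional a n k (\<Sum>l\<in>I. smult (c l) (p l)) =
     (\<Sum>l\<in>I. c l * eulerian_functional a n k (p l))"
  unfolding eulerian_functional_def poly_sum sum_distrib_left
  by (subst sum.swap) (simp add: mult.left_commute)

lemma eulerian_functional_basis:
  assumes "inj a" "k \<in> {0..int n}" "l \<in> {0..int n}"
  shows "eulerian_functional a n k (eulerian_basis a n l) = (if l = k then 1 else 0)"
proof (cases l k rule: linorder_cases)
  case less
  let ?w = "\<lambda>s. (\<Prod>t\<in>{-k..int n - k} - {s}. (a (int n - k + 1) - a t) / (a s - a t))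
                * poly (eulerian_basis a n l) (a s)"
  \<comment> \<open>The restored nodes \<open>1, ..., n - k\<close> index roots of the basis
    polynomial, because \<open>1 - l \<le> 1\<close> and \<open>n - k \<le> n - l\<close>.\<close>
  have "eulerian_functional a n k (eulerian_basis a n l) = (\<Sum>s\<in>{-k..int n - k}. ?w s)"
    unfolding eulerian_functional_def
    using assms less by (intro sum.mono_neutral_left) (auto simp: poly_eulerian_basis_eq_0)
  also have "\<dots> = poly (eulerian_basis a n l) (a (int n - k + 1))"
    using assms degree_eulerian_basis_le[of a n l]
    by (intro Lagrange_interpolation[symmetric]) (auto intro: inj_on_subset)
  \<comment> \<open>As \<open>l < k\<close>, also \<open>n - k + 1 \<le> n - l\<close>: the
    evaluation point is itself a root.\<close>
  also have "\<dots> = 0"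
    using assms less by (intro poly_eulerian_basis_eq_0) auto
  finally show ?thesis
    using less by simp
next
  case equal
  have nodes: "(\<Prod>t\<in>{-k..int n - k} - {-k}. (a (int n - k + 1) - a t) / (a (-k) - a t)) =
      (\<Prod>i\<in>{1..int n}. (a (int n - k + 1) - a (i - k)) / (a (-k) - a (i - k)))"
    by (rule prod.reindex_bij_witness[of _ "\<lambda>i. i - k" "\<lambda>t. t + k"]) auto
  have "eulerian_functional a n k (eulerian_basis a n k) =
      (\<Prod>t\<in>{-k..int n - k} - {-k}. (a (int n - k + 1) - a t) / (a (-k) - a t))
        * poly (eulerian_basis a n k) (a (-k))"
    unfolding eulerian_functional_def
    using assms by (subst sum.mono_neutral_right[of _ "{-k}"]) (auto simp: poly_eulerian_basis_eq_0)
  \<comment> \<open>After the shift by \<open>k\<close>, the Lagrange weight and the basis value are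
    reciprocal factor by factor.\<close>
  also have "\<dots> = 1"
    unfolding nodes poly_eulerian_basis prod.distrib[symmetric] using assms(1)
    by (intro prod.neutral) (auto simp: inj_eq)
  finally show ?thesis
    using equal by simp
next
  case greater
  \<comment> \<open>From \<open>k < l \<le> n\<close> follow \<open>1 - l \<le> -k\<close> and
    \<open>0 \<le> n - l\<close>, so every retained node is a root.\<close>
  then show ?thesis
    unfolding eulerian_functional_def
    using assms by (auto intro!: sum.neutral simp: poly_eulerian_basis_eq_0)
qed

lemma is_eulerian_coeffs_iff:
  "is_eulerian_coeffs a n c \<longleftrightarrow>
     [:0, 1:] ^ n = (\<Sum>k\<in>{0..int n}. smult (c k) (eulerian_basis a n k))
     \<and> (\<forall>k. k < 0 \<or> k > int n \<longrightarrow> c k = 0)"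
  by (simp add: is_eulerian_coeffs_def eulerian_basis_def)

text \<open>The coefficients are solved from the values at \<open>a_0, ..., a_{-n}\<close>; both
  sides have degree at most \<open>n\<close>, so agreement at these \<open>n + 1\<close> points
  suffices.\<close>

lemma is_eulerian_coeffs_exists:
  assumes "inj a"
  shows "\<exists>c. is_eulerian_coeffs a n c"
proof -
  define M where "M l j = poly (eulerian_basis a n (int l)) (a (- int j))" for l j
  \<comment> \<open>The index \<open>-j\<close> lies just below the root indices
    \<open>1 - j, ..., n - j\<close>.\<close>
  have "M j j \<noteq> 0" if "j \<le> n" for j
    unfolding M_def using assms by (intro poly_eulerian_basis_neq_0) auto
  then obtain d where d: "\<And>j. j \<le> n \<Longrightarrow> (\<Sum>l\<le>j. d l * M l j) = a (- int j) ^ n"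
    using triangular_system_solvable[of n M "\<lambda>j. a (- int j) ^ n"] by blast
  define c where "c k = (if k \<in> {0..int n} then d (nat k) else 0)" for k
  define q where "q = (\<Sum>k\<in>{0..int n}. smult (c k) (eulerian_basis a n k))"
  have "degree q \<le> n"
    unfolding q_def
    by (intro degree_sum_le order_trans[OF degree_smult_le] degree_eulerian_basis_le) auto
  moreover have "poly ([:0, 1:] ^ n) x = poly q x" if "x \<in> (\<lambda>j. a (- int j)) ` {..n}" for x
  proof -
    from that obtain j where j: "j \<le> n" "x = a (- int j)" by auto
    have "{0..int n} = int ` {..n}"
      by (simp add: atLeast0AtMost[symmetric] image_int_atLeastAtMost)
    then have "poly q x = (\<Sum>l\<le>n. d l * M l j)"
      by (simp add: q_def poly_sum sum.reindex c_def M_def j(2))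
    \<comment> \<open>For \<open>j < l \<le> n\<close>, the index \<open>-j\<close> lies in
      \<open>{1 - l..n - l}\<close>, so the entry vanishes.\<close>
    also have "\<dots> = (\<Sum>l\<le>j. d l * M l j)"
      using j by (intro sum.mono_neutral_right) (auto simp: M_def poly_eulerian_basis_eq_0)
    finally show ?thesis
      using d j by (simp add: poly_power)
  qed
  moreover have "card ((\<lambda>j. a (- int j)) ` {..n}) = Suc n"
    by (simp add: card_image inj_on_def inj_eq[OF assms])
  moreover have "degree ([:0, 1:: 'a:] ^ n) \<le> n"
    by (simp add: degree_power_eq)
  ultimately have "[:0, 1:] ^ n = q"
    by (intro poly_eqI_degree[where A = "(\<lambda>j. a (- int j)) ` {..n}"]) auto
  then have "is_eulerian_coeffs a n c"
    unfolding is_eulerian_coeffs_iff q_def by (simp add: c_def)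
  then show ?thesis by blast
qed

text \<open>Applying \<open>phi_k\<close> to the defining identity isolates \<open>c k\<close> by
  duality. As \<open>c\<close> is arbitrary, this serves both uniqueness and the explicit
  formula.\<close>

lemma is_eulerian_coeffs_eq_functional:
  assumes "inj a" "is_eulerian_coeffs a n c" "k \<in> {0..int n}"
  shows "c k = eulerian_functional a n k ([:0, 1:] ^ n)"
proof -
  have "eulerian_functional a n k ([:0, 1:] ^ n) =
      (\<Sum>l\<in>{0..int n}. c l * eulerian_functional a n k (eulerian_basis a n l))"
    using assms(2) by (simp add: is_eulerian_coeffs_iff eulerian_functional_sum_smult)
  also have "\<dots> = (\<Sum>l\<in>{0..int n}. if l = k then c l else 0)"
    using assms by (intro sum.cong) (auto simp: eulerian_functional_basis)
  also have "\<dots> = c k"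
    using assms(3) by simp
  finally show ?thesis by simp
qed

lemma is_eulerian_coeffs_gen_eulerian:
  assumes "inj a"
  shows "is_eulerian_coeffs a n (gen_eulerian a n)"
proof -
  have "c = d" if c: "is_eulerian_coeffs a n c" and d: "is_eulerian_coeffs a n d" for c d
  proof
    fix k
    show "c k = d k"
    proof (cases "k \<in> {0..int n}")
      case True
      then show ?thesis
        using is_eulerian_coeffs_eq_functional[OF assms c]
          is_eulerian_coeffs_eq_functional[OF assms d] by simp
    next
      case False
      then have "k < 0 \<or> k > int n" by auto
      then have "c k = 0" "d k = 0"
        using c d unfolding is_eulerian_coeffs_iff by blast+
      then show ?thesis by simp
    qed
  qed
  then have "\<exists>!c. is_eulerian_coeffs a n c"
    using is_eulerian_coeffs_exists[OF assms] by blast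
  then show ?thesis
    unfolding gen_eulerian_def by (rule theI')
qed

theorem mainTheorem2:
  fixes a :: "int \<Rightarrow> 'a::field" and n :: nat and k :: int
  assumes "inj a"
    and "0 \<le> k" and "k \<le> int n"
  shows "gen_eulerian a n k =
    (\<Sum>j\<in>{0..k}.
      (\<Prod>i\<in>{0..int n} - {k - j}.
         (a (int n - k + 1) - a (i - k)) / (a (- j) - a (i - k))) * a (- j) ^ n)"
proof -
  have "gen_eulerian a n k = eulerian_functional a n k ([:0, 1:] ^ n)"
    using assms by (intro is_eulerian_coeffs_eq_functional is_eulerian_coeffs_gen_eulerian) auto
  also have "\<dots> = (\<Sum>j\<in>{0..k}.
      (\<Prod>t\<in>{-k..int n - k} - {- j}. (a (int n - k + 1) - a t) / (a (- j) - a t)) * a (- j) ^ n)"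
    unfolding eulerian_functional_def
    by (rule sum.reindex_bij_witness[of _ uminus uminus]) (auto simp: poly_power)
  \<comment> \<open>Under \<open>t = i - k\<close>, the omitted node \<open>t = -j\<close> becomes
    \<open>i = k - j\<close>.\<close>
  also have "\<dots> = (\<Sum>j\<in>{0..k}.
      (\<Prod>i\<in>{0..int n} - {k - j}.
         (a (int n - k + 1) - a (i - k)) / (a (- j) - a (i - k))) * a (- j) ^ n)"
    by (intro sum.cong refl arg_cong2[where f = "(*)"]
        prod.reindex_bij_witness[of _ "\<lambda>i. i - k" "\<lambda>t. t + k"]) auto
  finally show ?thesis .
qed

end
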